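(* Let $k\ge 1$ be an integer and let $\alpha_k=\lfloor \frac{k+1}{2}\rfloor$. For every integer $n\ge 0$, $$\mathcal{D}_k(n)=\sum_{J\subseteq\{\alpha_k+1,\alpha_k+2,\ldots,k\}} p_{\mathbf a[k]}(n-m_J),\qquad\text{where } m_J=\sum_{i\in J}(3i-1).$$
   Context: A plane partition diamond of length $k$ of $n$ is a sequence $(a_1,a_2,\ldots,a_{3k+1})$ of nonnegative integers with $a_1+\cdots+a_{3k+1}=n$ such that, for all $0\le i\le k-1$, $a_{3i+1}\ge a_{3i+2}$, $a_{3i+1}\ge a_{3i+3}$, $a_{3i+2}\ge a_{3i+4}$, $a_{3i+3}\ge a_{3i+4}$. $\mathcal{D}_k(n)$ denotes the number of plane partition diamonds of length $k$ of $n$. For a sequence $\mathbf a=(a_1,\ldots,a_r)$ of positive integers, the restricted partition function $p_{\mathbf a}(n)$ is the number of tuples $(x_1,\ldots,x_r)$ of nonnegative integers with $a_1x_1+\cdots+a_rx_r=n$; in particular $p_{\mathbf a}(n)=0$ for $n<0$. For $k\ge1$, $\mathbf a[k]=(a[k]_1,\ldots,a[k]_{3k+1})$ is the sequence with $a[k]_j=j$ if $j\not\equiv 4\pmod 6$ and $a[k]_j=j/2$ if $j\equiv 4\pmod 6$. The empty set $J$ is allowed, with $m_\emptyset=0$; if $\alpha_k=k$ the index set is empty and $J=\emptyset$ is the only term. *)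

theory Defs
  imports Main "HOL-Library.FuncSet"
begin

text \<open>
  A finite sequence indexed by \<open>1, \<dots>, r\<close> is a function that is extensional on \<open>{1..r}\<close>,
  so that distinct functions are distinct sequences and counting them by \<open>card\<close> is meaningful.
\<close>

definition plane_partition_diamonds :: "nat \<Rightarrow> nat \<Rightarrow> (nat \<Rightarrow> nat) set" where
  "plane_partition_diamonds k n =
     {a \<in> {1..3 * k + 1} \<rightarrow>\<^sub>E UNIV.
        (\<Sum>j = 1..3 * k + 1. a j) = n \<and>
        (\<forall>i<k. a (3 * i + 1) \<ge> a (3 * i + 2) \<and> a (3 * i + 1) \<ge> a (3 * i + 3) \<and>
               a (3 * i + 2) \<ge> a (3 * i + 4) \<and> a (3 * i + 3) \<ge> a (3 * i + 4))}"

definition num_diamonds :: "nat \<Rightarrow> nat \<Rightarrow> nat" where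
  "num_diamonds k n = card (plane_partition_diamonds k n)"

text \<open>
  The restricted partition function of \<open>(a 1, \<dots>, a r)\<close>, meant for positive \<open>a j\<close>
  (otherwise the set below may be infinite). The last argument is an integer, so that the
  function vanishes at negative arguments.
\<close>

definition restricted_partitions :: "nat \<Rightarrow> (nat \<Rightarrow> nat) \<Rightarrow> int \<Rightarrow> nat" where
  "restricted_partitions r a n =
     card {x \<in> {1..r} \<rightarrow>\<^sub>E (UNIV :: nat set). int (\<Sum>j = 1..r. a j * x j) = n}"

text \<open>
  The entries \<open>a[k]\<^sub>j\<close> do not depend on \<open>k\<close>; only the length \<open>3 * k + 1\<close> does.
\<close>

definition diamond_part :: "nat \<Rightarrow> nat" where
  "diamond_part j = (if j mod 6 = 4 then j div 2 else j)"

end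

theory Submission imports Defs begin

text \<open>
  In a diamond with corners \<open>p \<ge> q, r \<ge> s\<close>, the differences \<open>p - max q r\<close>, \<open>\<bar>q - r\<bar>\<close>,
  \<open>min q r - s\<close> are free nonnegative integers, and raising one of them by one in the \<open>i\<close>-th diamond
  adds \<open>3 * i - 2\<close>, \<open>3 * i - 1\<close>, \<open>3 * i\<close> to the total. The only datum lost is the sign of
  \<open>q - r\<close>; coding the integer \<open>q - r\<close> by a natural number together with a bit of weight \<open>3 * i - 1\<close>
  (as \<open>r - q - 1\<close> with the bit set if \<open>q < r\<close>) gives pairs \<open>(x, E)\<close>, that is, the generating function
  \<open>(\<Prod>i=1..k. 1 + q^(3*i-1)) / (\<Prod>j=1..3*k+1. 1 - q^j)\<close>.
  For \<open>i \<le> (k + 1) div 2\<close> the part \<open>6 * i - 2\<close> occurs, and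
  \<open>(1 + q^(3*i-1)) / (1 - q^(6*i-2)) = 1 / (1 - q^(3*i-1))\<close>: the bit becomes the parity of the
  multiplicity of a part of half the size.
\<close>

definition marked_partitions :: "nat \<Rightarrow> nat \<Rightarrow> ((nat \<Rightarrow> nat) \<times> nat set) set" where
  "marked_partitions k n =
     {(x, E). x \<in> {1..3 * k + 1} \<rightarrow>\<^sub>E UNIV \<and> E \<subseteq> {1..k} \<and>
        (\<Sum>j = 1..3 * k + 1. j * x j) + (\<Sum>i\<in>E. 3 * i - 1) = n}"

section \<open>Index arithmetic and sums along a chain of diamonds\<close>

lemma diamond_index_cases [consumes 1, case_names top left right last]:
  fixes j k :: nat
  assumes "j \<in> {1..3 * k + 1}"
  obtains i where "i < k" "j = 3 * i + 1" | i where "i < k" "j = 3 * i + 2"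
    | i where "i < k" "j = 3 * i + 3" | "j = 3 * k + 1"
proof -
  consider "j = 3 * k + 1" | "j \<le> 3 * k" "j mod 3 = 0" | "j \<le> 3 * k" "j mod 3 = 1"
    | "j \<le> 3 * k" "j mod 3 = 2"
    using assms by fastforce
  then show thesis
  proof cases
    case 1
    then show thesis using that(4) by simp
  next
    case 2
    then have "j div 3 - 1 < k" "j = 3 * (j div 3 - 1) + 3" using assms by auto
    then show thesis using that(3) by blast
  next
    case 3
    then have "j div 3 < k" "j = 3 * (j div 3) + 1" by presburger+
    then show thesis using that(1) by blast
  next
    case 4
    then have "j div 3 < k" "j = 3 * (j div 3) + 2" by presburger+
    then show thesis using that(2) by blast
  qed
qed

text \<open>The simplifier turns small index sums into nested \<open>Suc\<close> terms or reorders
  them; these rules bring the indices of one diamond back to common forms, so that facts about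
  shared corners match.\<close>

lemma diamond_index_simps:
  fixes i :: nat
  shows "Suc (Suc (Suc (3 * i))) = 3 * i + 3" "Suc (3 * i + 3) = 3 * i + 4" "3 + 3 * i = 3 * i + 3"
    "3 * i + 3 - Suc 0 = Suc (Suc (3 * i))"
  by simp_all

lemma sum_diamonds:
  fixes f :: "nat \<Rightarrow> nat"
  shows "(\<Sum>j = 1..3 * k + 1. f j)
    = (\<Sum>i<k. f (3 * i + 1) + f (3 * i + 2) + f (3 * i + 3)) + f (3 * k + 1)"
proof (induction k)
  case (Suc k)
  have "{1..3 * Suc k + 1} = insert (3 * k + 4) (insert (3 * k + 3) (insert (3 * k + 2) {1..3 * k + 1}))"
    by auto
  then show ?case using Suc by (simp add: diamond_index_simps)
qed simp

text \<open>Marks are counted from 1 but diamonds from 0, so diamond \<open>i\<close> carries mark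
  \<open>Suc i\<close>. As 0/1 factors the marks can be summed along the chain together with the
  differences.\<close>

lemma sum_marks:
  fixes f :: "nat \<Rightarrow> nat"
  assumes "E \<subseteq> {1..k}"
  shows "(\<Sum>i\<in>E. f i) = (\<Sum>i<k. of_bool (Suc i \<in> E) * f (Suc i))"
proof -
  have "(\<Sum>i<k. of_bool (Suc i \<in> E) * f (Suc i)) = (\<Sum>i\<in>{1..k}. of_bool (i \<in> E) * f i)"
    by (rule sum.reindex_bij_witness[of _ "\<lambda>i. i - 1" Suc]) auto
  also have "\<dots> = (\<Sum>i\<in>E. f i)"
    using assms by (intro sum.mono_neutral_cong_right) auto
  finally show ?thesis by simp
qed

text \<open>Summation by parts: a difference in diamond \<open>i\<close> is a summand of all
  \<open>3 * i\<close> earlier entries and of some corners of its own diamond. Only the sum of the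
  two middle corners enters, so their order is irrelevant and the lemma serves encoding and decoding
  alike.\<close>

lemma diamond_sum:
  fixes a x e :: "nat \<Rightarrow> nat"
  assumes top: "\<And>i. i < k \<Longrightarrow>
      a (3 * i + 1) = a (3 * i + 4) + x (3 * i + 3) + (x (3 * i + 2) + e i) + x (3 * i + 1)"
    and mid: "\<And>i. i < k \<Longrightarrow>
      a (3 * i + 2) + a (3 * i + 3) = 2 * (a (3 * i + 4) + x (3 * i + 3)) + (x (3 * i + 2) + e i)"
    and last: "a (3 * k + 1) = x (3 * k + 1)"
  shows "(\<Sum>j = 1..3 * k + 1. a j) = (\<Sum>j = 1..3 * k + 1. j * x j) + (\<Sum>i<k. e i * (3 * i + 2))"
proof -
  \<comment> \<open>Each of the \<open>3 * m\<close> entries before the corner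
    \<open>3 * m + 1\<close> contains that corner's value once; the last term collects these copies,
    and \<open>top\<close> splits them further when the next diamond is added.\<close>
  have "(\<Sum>i<m. a (3 * i + 1) + a (3 * i + 2) + a (3 * i + 3))
    = (\<Sum>i<m. (3 * i + 1) * x (3 * i + 1) + (3 * i + 2) * x (3 * i + 2) + (3 * i + 3) * x (3 * i + 3))
      + (\<Sum>i<m. e i * (3 * i + 2)) + 3 * m * a (3 * m + 1)" if "m \<le> k" for m
    using that
  proof (induction m)
    case (Suc m)
    have "a (3 * Suc m + 1) = a (3 * m + 4)" by (simp add: diamond_index_simps)
    then show ?case
      using Suc mid[of m] top[of m] by (simp add: algebra_simps)
  qed simp
  from this[of k] show ?thesis unfolding sum_diamonds last by (simp add: algebra_simps)
qed

section \<open>The bijection between diamonds and marked partitions\<close>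

definition diamond_encode :: "nat \<Rightarrow> (nat \<Rightarrow> nat) \<Rightarrow> (nat \<Rightarrow> nat) \<times> nat set" where
  "diamond_encode k a =
    (\<lambda>j\<in>{1..3 * k + 1}.
       if j = 3 * k + 1 then a j
       else if j mod 3 = 1 then a j - max (a (j + 1)) (a (j + 2))
       else if j mod 3 = 2 then (if a j < a (j + 1) then a (j + 1) - a j - 1 else a j - a (j + 1))
       else min (a (j - 1)) (a j) - a (j + 1),
     {i \<in> {1..k}. a (3 * i - 1) < a (3 * i)})"

text \<open>The value at the corner \<open>3 * i + 1\<close>: the last entry plus the total drop
  over all diamonds from \<open>i\<close> on. For \<open>i = k\<close> the sum is empty and only the
  last entry remains.\<close>

definition diamond_top :: "nat \<Rightarrow> (nat \<Rightarrow> nat) \<Rightarrow> nat set \<Rightarrow> nat \<Rightarrow> nat" where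
  "diamond_top k x E i = x (3 * k + 1) +
     (\<Sum>l = i..<k. x (3 * l + 3) + (x (3 * l + 2) + of_bool (Suc l \<in> E)) + x (3 * l + 1))"

text \<open>Both middle corners start from the bottom corner plus the third difference; the mark
  decides which of them receives the middle difference. For \<open>j = 3 * i + 3\<close> the
  quotient \<open>j div 3\<close> is already \<open>Suc i\<close>, whereas
  \<open>j = 3 * i + 2\<close> needs the \<open>Suc\<close>.\<close>

definition diamond_decode :: "nat \<Rightarrow> (nat \<Rightarrow> nat) \<times> nat set \<Rightarrow> nat \<Rightarrow> nat" where
  "diamond_decode k = (\<lambda>(x, E). \<lambda>j\<in>{1..3 * k + 1}.
     if j mod 3 = 1 then diamond_top k x E (j div 3)
     else if j mod 3 = 2 then
       diamond_top k x E (Suc (j div 3)) + x (j + 1) + (if Suc (j div 3) \<in> E then 0 else x j)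
     else diamond_top k x E (j div 3) + x j + (if j div 3 \<in> E then x (j - 1) + 1 else 0))"

text \<open>The residues are evaluated here once and for all. The index \<open>3 * k + 1\<close>
  needs its own clause: it too is 1 modulo 3, but it opens no diamond.\<close>

lemma diamond_encode_fst:
  fixes a k
  defines "x \<equiv> fst (diamond_encode k a)"
  shows "i < k \<Longrightarrow> x (3 * i + 1) = a (3 * i + 1) - max (a (3 * i + 2)) (a (3 * i + 3))"
    and "i < k \<Longrightarrow> x (3 * i + 2) = (if a (3 * i + 2) < a (3 * i + 3)
           then a (3 * i + 3) - a (3 * i + 2) - 1 else a (3 * i + 2) - a (3 * i + 3))"
    and "i < k \<Longrightarrow> x (3 * i + 3) = min (a (3 * i + 2)) (a (3 * i + 3)) - a (3 * i + 4)"
    and "x (3 * k + 1) = a (3 * k + 1)"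
proof -
  have "(3 * i + 1) mod 3 = 1" "(3 * i + 2) mod 3 = 2" "(3 * i + 3) mod 3 = 0" by presburger+
  then show "i < k \<Longrightarrow> x (3 * i + 1) = a (3 * i + 1) - max (a (3 * i + 2)) (a (3 * i + 3))"
    and "i < k \<Longrightarrow> x (3 * i + 2) = (if a (3 * i + 2) < a (3 * i + 3)
           then a (3 * i + 3) - a (3 * i + 2) - 1 else a (3 * i + 2) - a (3 * i + 3))"
    and "i < k \<Longrightarrow> x (3 * i + 3) = min (a (3 * i + 2)) (a (3 * i + 3)) - a (3 * i + 4)"
    by (auto simp: x_def diamond_encode_def diamond_index_simps)
  show "x (3 * k + 1) = a (3 * k + 1)" by (simp add: x_def diamond_encode_def)
qed

lemma diamond_encode_snd:
  "i < k \<Longrightarrow> Suc i \<in> snd (diamond_encode k a) \<longleftrightarrow> a (3 * i + 2) < a (3 * i + 3)"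
  by (simp add: diamond_encode_def diamond_index_simps)

lemma diamond_decode_simps:
  fixes x E k
  defines "a \<equiv> diamond_decode k (x, E)" and "h \<equiv> diamond_top k x E"
  shows "i \<le> k \<Longrightarrow> a (3 * i + 1) = h i"
    and "i < k \<Longrightarrow> a (3 * i + 4) = h (Suc i)"
    and "i < k \<Longrightarrow> a (3 * i + 2) = h (Suc i) + x (3 * i + 3) + (if Suc i \<in> E then 0 else x (3 * i + 2))"
    and "i < k \<Longrightarrow> a (3 * i + 3) = h (Suc i) + x (3 * i + 3) + (if Suc i \<in> E then x (3 * i + 2) + 1 else 0)"
proof -
  have *: "(3 * i + 1) mod 3 = 1" "(3 * i + 2) mod 3 = 2" "(3 * i + 3) mod 3 = 0" "(3 * i + 4) mod 3 = 1"
    "(3 * i + 1) div 3 = i" "(3 * i + 2) div 3 = i" "(3 * i + 3) div 3 = Suc i" "(3 * i + 4) div 3 = Suc i"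
    by presburger+
  show "i \<le> k \<Longrightarrow> a (3 * i + 1) = h i"
    using * by (simp add: a_def h_def diamond_decode_def)
  show "i < k \<Longrightarrow> a (3 * i + 4) = h (Suc i)"
    using * by (simp add: a_def h_def diamond_decode_def)
  show "i < k \<Longrightarrow> a (3 * i + 2) = h (Suc i) + x (3 * i + 3) + (if Suc i \<in> E then 0 else x (3 * i + 2))"
    using * by (simp add: a_def h_def diamond_decode_def diamond_index_simps)
  show "i < k \<Longrightarrow> a (3 * i + 3) = h (Suc i) + x (3 * i + 3) + (if Suc i \<in> E then x (3 * i + 2) + 1 else 0)"
    using * by (simp add: a_def h_def diamond_decode_def diamond_index_simps)
qed

lemma diamond_top_step:
  "i < k \<Longrightarrow> diamond_top k x E i = diamond_top k x E (Suc i) + x (3 * i + 3)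
     + (x (3 * i + 2) + of_bool (Suc i \<in> E)) + x (3 * i + 1)"
  by (simp add: diamond_top_def sum.atLeast_Suc_lessThan)

text \<open>The diamond inequalities make every truncated subtraction in
  \<open>diamond_encode\<close> exact, so a diamond can be rebuilt from its bottom corner
  upwards.\<close>

lemma diamond_encode_step:
  fixes a k
  defines "x \<equiv> fst (diamond_encode k a)" and "E \<equiv> snd (diamond_encode k a)"
  assumes "a \<in> plane_partition_diamonds k n" "i < k"
  shows "a (3 * i + 1) = a (3 * i + 4) + x (3 * i + 3)
      + (x (3 * i + 2) + of_bool (Suc i \<in> E)) + x (3 * i + 1)"
    and "a (3 * i + 2) = a (3 * i + 4) + x (3 * i + 3) + (if Suc i \<in> E then 0 else x (3 * i + 2))"
    and "a (3 * i + 3) = a (3 * i + 4) + x (3 * i + 3) + (if Suc i \<in> E then x (3 * i + 2) + 1 else 0)"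
proof -
  have "a (3 * i + 1) \<ge> a (3 * i + 2)" "a (3 * i + 1) \<ge> a (3 * i + 3)"
    "a (3 * i + 2) \<ge> a (3 * i + 4)" "a (3 * i + 3) \<ge> a (3 * i + 4)"
    using assms(3,4) by (auto simp: plane_partition_diamonds_def)
  then show "a (3 * i + 1) = a (3 * i + 4) + x (3 * i + 3)
      + (x (3 * i + 2) + of_bool (Suc i \<in> E)) + x (3 * i + 1)"
    and "a (3 * i + 2) = a (3 * i + 4) + x (3 * i + 3) + (if Suc i \<in> E then 0 else x (3 * i + 2))"
    and "a (3 * i + 3) = a (3 * i + 4) + x (3 * i + 3) + (if Suc i \<in> E then x (3 * i + 2) + 1 else 0)"
    unfolding x_def E_def diamond_encode_fst(1-3)[OF \<open>i < k\<close>] diamond_encode_snd[OF \<open>i < k\<close>]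
    by (simp_all add: max_def min_def)
qed

lemma diamond_encode_in:
  assumes "a \<in> plane_partition_diamonds k n"
  shows "diamond_encode k a \<in> marked_partitions k n"
proof -
  define x E where "x = fst (diamond_encode k a)" and "E = snd (diamond_encode k a)"
  note step = diamond_encode_step[OF assms, folded x_def E_def]
  have E: "E \<subseteq> {1..k}" by (auto simp: E_def diamond_encode_def)
  have "(\<Sum>j = 1..3 * k + 1. a j)
    = (\<Sum>j = 1..3 * k + 1. j * x j) + (\<Sum>i<k. of_bool (Suc i \<in> E) * (3 * i + 2))"
  proof (rule diamond_sum)
    show "a (3 * i + 2) + a (3 * i + 3)
      = 2 * (a (3 * i + 4) + x (3 * i + 3)) + (x (3 * i + 2) + of_bool (Suc i \<in> E))" if "i < k" for i
      using step(2,3)[OF that] by simp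
    show "a (3 * k + 1) = x (3 * k + 1)" unfolding x_def diamond_encode_fst(4) ..
  qed (rule step(1))
  moreover have "(\<Sum>j = 1..3 * k + 1. a j) = n"
    using assms by (simp add: plane_partition_diamonds_def)
  moreover have "x \<in> {1..3 * k + 1} \<rightarrow>\<^sub>E UNIV"
    by (simp add: x_def diamond_encode_def)
  ultimately have "(x, E) \<in> marked_partitions k n"
    using E by (simp add: marked_partitions_def sum_marks[OF E])
  then show ?thesis by (simp add: x_def E_def)
qed

lemma diamond_decode_in:
  assumes "(x, E) \<in> marked_partitions k n"
  shows "diamond_decode k (x, E) \<in> plane_partition_diamonds k n"
proof -
  define a where "a = diamond_decode k (x, E)"
  note dec = diamond_decode_simps[of _ k x E, folded a_def]
  from assms have E: "E \<subseteq> {1..k}"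
    and n: "(\<Sum>j = 1..3 * k + 1. j * x j) + (\<Sum>i\<in>E. 3 * i - 1) = n"
    by (simp_all add: marked_partitions_def)
  have "(\<Sum>j = 1..3 * k + 1. a j)
    = (\<Sum>j = 1..3 * k + 1. j * x j) + (\<Sum>i<k. of_bool (Suc i \<in> E) * (3 * i + 2))"
  proof (rule diamond_sum)
    show "a (3 * i + 1) = a (3 * i + 4) + x (3 * i + 3)
      + (x (3 * i + 2) + of_bool (Suc i \<in> E)) + x (3 * i + 1)" if "i < k" for i
      using dec(1,2)[of i] diamond_top_step[OF that] that by simp
    show "a (3 * i + 2) + a (3 * i + 3)
      = 2 * (a (3 * i + 4) + x (3 * i + 3)) + (x (3 * i + 2) + of_bool (Suc i \<in> E))" if "i < k" for i
      using dec(2-4)[OF that] by simp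
    show "a (3 * k + 1) = x (3 * k + 1)"
      using dec(1)[of k] by (simp add: diamond_top_def)
  qed
  then have "(\<Sum>j = 1..3 * k + 1. a j) = n"
    using n by (simp add: sum_marks[OF E])
  moreover have "a (3 * i + 1) \<ge> a (3 * i + 2) \<and> a (3 * i + 1) \<ge> a (3 * i + 3) \<and>
      a (3 * i + 2) \<ge> a (3 * i + 4) \<and> a (3 * i + 3) \<ge> a (3 * i + 4)" if "i < k" for i
    using dec(1)[of i] dec(2-4)[OF that] diamond_top_step[OF that, of x E] that by simp
  moreover have "a \<in> {1..3 * k + 1} \<rightarrow>\<^sub>E UNIV"
    by (simp add: a_def diamond_decode_def)
  ultimately show ?thesis by (simp add: plane_partition_diamonds_def flip: a_def)
qed

lemma diamond_decode_encode:
  assumes "a \<in> plane_partition_diamonds k n"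
  shows "diamond_decode k (diamond_encode k a) = a"
proof -
  define x E where "x = fst (diamond_encode k a)" and "E = snd (diamond_encode k a)"
  have xE: "diamond_encode k a = (x, E)" by (simp add: x_def E_def)
  note steps = diamond_encode_step[OF assms, folded x_def E_def]
  \<comment> \<open>The induction descends from \<open>k\<close>, since the values are rebuilt
    backwards from the last entry.\<close>
  have tops: "diamond_top k x E i = a (3 * i + 1)" if "i \<le> k" for i
    using that
  proof (induction i rule: inc_induct)
    case base
    then show ?case using diamond_encode_fst(4)[of k a] by (simp add: diamond_top_def x_def)
  next
    case (step m)
    have "a (3 * Suc m + 1) = a (3 * m + 4)" by (simp add: diamond_index_simps)
    then show ?case
      using step diamond_top_step[of m k x E] steps(1)[of m] by simp
  qed
  have tops': "diamond_top k x E (Suc i) = a (3 * i + 4)" if "i < k" for i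
    using tops[of "Suc i"] that by (simp add: diamond_index_simps)
  show ?thesis unfolding xE
  proof (rule extensionalityI[of _ "{1..3 * k + 1}"])
    show "diamond_decode k (x, E) \<in> extensional {1..3 * k + 1}"
      by (simp add: diamond_decode_def)
    show "a \<in> extensional {1..3 * k + 1}"
      using assms by (auto simp: plane_partition_diamonds_def PiE_def)
  next
    fix j assume "j \<in> {1..3 * k + 1}"
    then show "diamond_decode k (x, E) j = a j"
    proof (cases rule: diamond_index_cases)
      case (top i)
      then show ?thesis using diamond_decode_simps(1)[of i k x E] tops[of i] by simp
    next
      case (left i)
      then show ?thesis using diamond_decode_simps(3)[of i k x E] steps(2)[of i] tops'[of i] by simp
    next
      case (right i)
      then show ?thesis using diamond_decode_simps(4)[of i k x E] steps(3)[of i] tops'[of i] by simp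
    next
      case last
      then show ?thesis using diamond_decode_simps(1)[of k k x E] tops[of k] by simp
    qed
  qed
qed

lemma diamond_encode_decode:
  assumes "(x, E) \<in> marked_partitions k n"
  shows "diamond_encode k (diamond_decode k (x, E)) = (x, E)"
proof -
  define a where "a = diamond_decode k (x, E)"
  note dec = diamond_decode_simps[of _ k x E, folded a_def]
  from assms have E: "E \<subseteq> {1..k}" and x: "x \<in> extensional {1..3 * k + 1}"
    by (auto simp: marked_partitions_def PiE_def)
  \<comment> \<open>With a mark the right corner exceeds the left by
    \<open>x (3 * l + 2) + 1\<close>, which is positive; without one the left corner is at least the
    right. So the strict comparison reads off the mark.\<close>
  have "snd (diamond_encode k a) = E"
  proof (rule set_eqI)
    fix i
    show "i \<in> snd (diamond_encode k a) \<longleftrightarrow> i \<in> E"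
    proof (cases "i \<in> {1..k}")
      case True
      then obtain l where "i = Suc l" "l < k" by (cases i) auto
      then show ?thesis using dec(3,4)[of l] by (simp add: diamond_encode_snd)
    next
      case False
      then show ?thesis using E by (auto simp: diamond_encode_def)
    qed
  qed
  moreover have "fst (diamond_encode k a) = x"
  proof (rule extensionalityI[OF _ x])
    show "fst (diamond_encode k a) \<in> extensional {1..3 * k + 1}"
      by (simp add: diamond_encode_def)
    fix j assume "j \<in> {1..3 * k + 1}"
    then show "fst (diamond_encode k a) j = x j"
    proof (cases rule: diamond_index_cases)
      case (top i)
      then show ?thesis using dec(1)[of i] dec(3,4)[of i] diamond_top_step[of i k x E]
          diamond_encode_fst(1)[of i k a] by simp
    next
      case (left i)
      then show ?thesis using dec(3,4)[of i] diamond_encode_fst(2)[of i k a] by simp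
    next
      case (right i)
      then show ?thesis using dec(2-4)[of i] diamond_encode_fst(3)[of i k a] by simp
    next
      case last
      then show ?thesis using dec(1)[of k] diamond_encode_fst(4)[of k a] by (simp add: diamond_top_def)
    qed
  qed
  ultimately show ?thesis by (simp add: prod_eq_iff flip: a_def)
qed

lemma bij_betw_diamond_encode:
  "bij_betw (diamond_encode k) (plane_partition_diamonds k n) (marked_partitions k n)"
proof (rule bij_betw_byWitness[where f' = "diamond_decode k"])
  show "\<forall>a\<in>plane_partition_diamonds k n. diamond_decode k (diamond_encode k a) = a"
    by (simp add: diamond_decode_encode)
  show "\<forall>p\<in>marked_partitions k n. diamond_encode k (diamond_decode k p) = p"
    by (metis diamond_encode_decode surj_pair)
  show "diamond_encode k ` plane_partition_diamonds k n \<subseteq> marked_partitions k n"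
    by (auto intro: diamond_encode_in)
  show "diamond_decode k ` marked_partitions k n \<subseteq> plane_partition_diamonds k n"
    by (auto intro: diamond_decode_in)
qed

section \<open>Restricted partitions and the absorption of marks into halved parts\<close>

lemma finite_restricted_partitions:
  fixes c :: "nat \<Rightarrow> nat"
  assumes "\<And>j. j \<in> {1..r} \<Longrightarrow> c j > 0"
  shows "finite {x \<in> {1..r} \<rightarrow>\<^sub>E (UNIV :: nat set). int (\<Sum>j = 1..r. c j * x j) = m}"
proof (rule finite_subset)
  \<comment> \<open>Positive parts bound every multiplicity by the total, which confines the tuples
    to a finite box. For negative \<open>m\<close> there are no tuples at all.\<close>
  show "finite ({1..r} \<rightarrow>\<^sub>E {..nat m})" by (simp add: finite_PiE)
  show "{x \<in> {1..r} \<rightarrow>\<^sub>E UNIV. int (\<Sum>j = 1..r. c j * x j) = m} \<subseteq> {1..r} \<rightarrow>\<^sub>E {..nat m}"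
  proof
    fix x assume "x \<in> {x \<in> {1..r} \<rightarrow>\<^sub>E UNIV. int (\<Sum>j = 1..r. c j * x j) = m}"
    then have x: "x \<in> {1..r} \<rightarrow>\<^sub>E UNIV" and "m = int (\<Sum>j = 1..r. c j * x j)" by blast+
    then have m: "nat m = (\<Sum>j = 1..r. c j * x j)" by (metis nat_int)
    have "x j \<le> nat m" if "j \<in> {1..r}" for j
    proof -
      have "x j \<le> c j * x j" using assms[OF that] by simp
      also have "\<dots> \<le> (\<Sum>j = 1..r. c j * x j)" using that by (intro member_le_sum) auto
      finally show ?thesis by (simp add: m)
    qed
    then show "x \<in> {1..r} \<rightarrow>\<^sub>E {..nat m}" using x by (auto simp: PiE_def)
  qed
qed

text \<open>Mark \<open>i\<close> belongs to the part \<open>j = 6 * i - 2\<close>, whence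
  \<open>i = (j + 2) div 6\<close>, and its weight \<open>3 * i - 1\<close> is half of
  \<open>j\<close>. Marks above \<open>(k + 1) div 2\<close> have no such part within range and stay
  behind as the set J.\<close>

definition absorb_marks :: "nat \<Rightarrow> (nat \<Rightarrow> nat) \<times> nat set \<Rightarrow> nat set \<times> (nat \<Rightarrow> nat)" where
  "absorb_marks k = (\<lambda>(x, E). (E \<inter> {(k + 1) div 2 + 1..k},
     \<lambda>j\<in>{1..3 * k + 1}. if j mod 6 = 4 then 2 * x j + of_bool ((j + 2) div 6 \<in> E) else x j))"

definition release_marks :: "nat \<Rightarrow> nat set \<times> (nat \<Rightarrow> nat) \<Rightarrow> (nat \<Rightarrow> nat) \<times> nat set" where
  "release_marks k = (\<lambda>(J, y).
     (\<lambda>j\<in>{1..3 * k + 1}. if j mod 6 = 4 then y j div 2 else y j,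
      J \<union> {i \<in> {1..(k + 1) div 2}. odd (y (6 * i - 2))}))"

text \<open>The last clause is the origin of the threshold \<alpha>:
  \<open>6 * i - 2 \<le> 3 * k + 1\<close> means \<open>2 * i \<le> k + 1\<close>.\<close>

lemma halved_part_index:
  fixes i :: nat
  assumes "1 \<le> i"
  shows "(6 * i - 2) mod 6 = 4" "(6 * i - 2 + 2) div 6 = i" "1 \<le> 6 * i - 2"
    "(6 * i - 2) div 2 = 3 * i - 1" "6 * i - 2 \<le> 3 * k + 1 \<longleftrightarrow> i \<le> (k + 1) div 2"
proof -
  obtain m where i: "i = Suc m" using assms by (cases i) auto
  then have *: "6 * i - 2 = 4 + m * 6" "3 * i - 1 = 2 + 3 * m" by simp_all
  show "(6 * i - 2) mod 6 = 4" unfolding * by simp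
  show "(6 * i - 2 + 2) div 6 = i" using i by simp
  show "1 \<le> 6 * i - 2" unfolding * by simp
  show "(6 * i - 2) div 2 = 3 * i - 1" unfolding * by simp
  show "6 * i - 2 \<le> 3 * k + 1 \<longleftrightarrow> i \<le> (k + 1) div 2" using i by auto
qed

lemma halved_part_obtain:
  fixes j :: nat
  assumes "j mod 6 = 4"
  obtains i where "1 \<le> i" "j = 6 * i - 2"
proof -
  have "j = 6 * (j div 6) + 4" using assms by (metis mult_div_mod_eq)
  then show thesis using that[of "j div 6 + 1"] by simp
qed

text \<open>Doubling the multiplicity compensates for halving the part, and an absorbed mark becomes
  one further copy of the half part, of the same weight \<open>3 * i - 1\<close>.\<close>

lemma absorb_marks_weight:
  assumes "E \<subseteq> {1..k}"
  shows "(\<Sum>j = 1..3 * k + 1. diamond_part j * snd (absorb_marks k (x, E)) j)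
      + (\<Sum>i\<in>fst (absorb_marks k (x, E)). 3 * i - 1)
    = (\<Sum>j = 1..3 * k + 1. j * x j) + (\<Sum>i\<in>E. 3 * i - 1)"
proof -
  let ?\<alpha> = "(k + 1) div 2"
  have fin: "finite E" using assms finite_subset by blast
  have pointwise: "diamond_part j * (if j mod 6 = 4 then 2 * x j + of_bool ((j + 2) div 6 \<in> E) else x j)
      = j * x j + (if j mod 6 = 4 \<and> (j + 2) div 6 \<in> E then j div 2 else 0)" for j :: nat
  proof (cases "j mod 6 = 4")
    case True
    then have "j = 2 * (j div 2)" by presburger
    then have "j div 2 * (2 * x j) = j * x j" by (metis mult.assoc mult.commute)
    then show ?thesis using True by (simp add: diamond_part_def distrib_left)
  qed (simp add: diamond_part_def)
  have "(\<Sum>j = 1..3 * k + 1. if j mod 6 = 4 \<and> (j + 2) div 6 \<in> E then j div 2 else 0)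
      = (\<Sum>j\<in>{j \<in> {1..3 * k + 1}. j mod 6 = 4 \<and> (j + 2) div 6 \<in> E}. j div 2)"
    by (rule sum.inter_filter[symmetric]) simp
  \<comment> \<open>The substitution \<open>j = 6 * i - 2\<close> matches the halved parts in range
    with the marks up to \<alpha>.\<close>
  also have "\<dots> = (\<Sum>i\<in>E \<inter> {1..?\<alpha>}. 3 * i - 1)"
  proof (rule sum.reindex_bij_witness[of _ "\<lambda>i. 6 * i - 2" "\<lambda>j. (j + 2) div 6"])
    fix j assume "j \<in> {j \<in> {1..3 * k + 1}. j mod 6 = 4 \<and> (j + 2) div 6 \<in> E}"
    then have j: "j \<le> 3 * k + 1" "j mod 6 = 4" "(j + 2) div 6 \<in> E" by auto
    then obtain i where i: "1 \<le> i" "j = 6 * i - 2" by (elim halved_part_obtain)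
    then have ij: "(j + 2) div 6 = i" by (simp only: halved_part_index)
    show "6 * ((j + 2) div 6) - 2 = j" unfolding ij by (rule i(2)[symmetric])
    show "3 * ((j + 2) div 6) - 1 = j div 2"
      unfolding ij unfolding i(2) halved_part_index(4)[OF i(1)] ..
    have "i \<le> ?\<alpha>" using j(1) unfolding i(2) halved_part_index(5)[OF i(1)] .
    then show "(j + 2) div 6 \<in> E \<inter> {1..?\<alpha>}" using j(3) i(1) unfolding ij by simp
  next
    fix i assume "i \<in> E \<inter> {1..?\<alpha>}"
    then have i: "i \<in> E" "1 \<le> i" "i \<le> ?\<alpha>" by auto
    note * = halved_part_index[OF i(2)]
    show "(6 * i - 2 + 2) div 6 = i" by (rule *)
    show "6 * i - 2 \<in> {j \<in> {1..3 * k + 1}. j mod 6 = 4 \<and> (j + 2) div 6 \<in> E}"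
      unfolding mem_Collect_eq atLeastAtMost_iff * using i by simp
  qed
  also have "\<dots> + (\<Sum>i\<in>E \<inter> {?\<alpha> + 1..k}. 3 * i - 1) = (\<Sum>i\<in>E. 3 * i - 1)"
  proof (subst sum.union_disjoint[symmetric])
    have "E \<inter> {1..?\<alpha>} \<union> E \<inter> {?\<alpha> + 1..k} = E" using assms by force
    then show "(\<Sum>i\<in>E \<inter> {1..?\<alpha>} \<union> E \<inter> {?\<alpha> + 1..k}. 3 * i - 1) = (\<Sum>i\<in>E. 3 * i - 1)" by simp
  qed (use fin in auto)
  finally show ?thesis
    by (simp add: absorb_marks_def pointwise sum.distrib add.assoc)
qed

lemma release_absorb:
  assumes "x \<in> extensional {1..3 * k + 1}" "E \<subseteq> {1..k}"
  shows "release_marks k (absorb_marks k (x, E)) = (x, E)"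
proof -
  \<comment> \<open>Up to \<alpha> the index \<open>6 * i - 2\<close> lies in the domain, so the
    restricted function yields twice a multiplicity plus the bit there, and its parity is the
    mark.\<close>
  have "(6 * i - 2) mod 6 = 4 \<and> (6 * i - 2 + 2) div 6 = i \<and> 6 * i - 2 \<in> {1..3 * k + 1}"
    if "i \<in> {1..(k + 1) div 2}" for i
  proof -
    have "1 \<le> i" "i \<le> (k + 1) div 2" using that by auto
    then show ?thesis
      unfolding atLeastAtMost_iff halved_part_index[OF \<open>1 \<le> i\<close>] by simp
  qed
  then have odd: "odd (snd (absorb_marks k (x, E)) (6 * i - 2)) \<longleftrightarrow> i \<in> E" if "i \<in> {1..(k + 1) div 2}" for i
    unfolding absorb_marks_def using that by (simp del: atLeastAtMost_iff)
  have "snd (release_marks k (absorb_marks k (x, E)))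
      = fst (absorb_marks k (x, E)) \<union> {i \<in> {1..(k + 1) div 2}. odd (snd (absorb_marks k (x, E)) (6 * i - 2))}"
    by (simp add: release_marks_def case_prod_unfold)
  also have "{i \<in> {1..(k + 1) div 2}. odd (snd (absorb_marks k (x, E)) (6 * i - 2))}
      = E \<inter> {1..(k + 1) div 2}"
    using odd by blast
  also have "fst (absorb_marks k (x, E)) = E \<inter> {(k + 1) div 2 + 1..k}"
    by (simp add: absorb_marks_def)
  also have "E \<inter> {(k + 1) div 2 + 1..k} \<union> E \<inter> {1..(k + 1) div 2} = E"
    using assms(2) by force
  finally have "snd (release_marks k (absorb_marks k (x, E))) = E" .
  moreover have "fst (release_marks k (absorb_marks k (x, E))) j = x j" for j
  proof (cases "j \<in> {1..3 * k + 1}")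
    case True
    then have "fst (release_marks k (absorb_marks k (x, E))) j
        = (if j mod 6 = 4 then (2 * x j + of_bool ((j + 2) div 6 \<in> E)) div 2 else x j)"
      by (simp add: release_marks_def absorb_marks_def del: atLeastAtMost_iff)
    then show ?thesis by simp
  next
    case False
    then show ?thesis using assms(1)
      by (simp add: release_marks_def absorb_marks_def extensional_def del: atLeastAtMost_iff)
  qed
  ultimately show ?thesis by (simp add: prod_eq_iff fun_eq_iff)
qed

lemma absorb_release:
  assumes "y \<in> extensional {1..3 * k + 1}" "J \<subseteq> {(k + 1) div 2 + 1..k}"
  shows "absorb_marks k (release_marks k (J, y)) = (J, y)"
proof -
  have "fst (absorb_marks k (release_marks k (J, y))) = J"
    using assms(2) by (auto simp: release_marks_def absorb_marks_def)
  moreover have "snd (absorb_marks k (release_marks k (J, y))) j = y j" for j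
  proof (cases "j \<in> {1..3 * k + 1} \<and> j mod 6 = 4")
    case True
    then have j: "j \<le> 3 * k + 1" "j mod 6 = 4" by auto
    then obtain l where l: "1 \<le> l" "j = 6 * l - 2" by (elim halved_part_obtain)
    have "(j + 2) div 6 = l" unfolding l(2) by (rule halved_part_index[OF l(1)])
    moreover have "l \<le> (k + 1) div 2"
      using j(1) unfolding l(2) halved_part_index(5)[OF l(1)] .
    ultimately have i: "6 * ((j + 2) div 6) - 2 = j" "1 \<le> (j + 2) div 6" "(j + 2) div 6 \<le> (k + 1) div 2"
      using l by simp_all
    \<comment> \<open>J holds only marks above \<alpha>, so the released mark of \<open>j\<close>
      comes from the parity of \<open>y j\<close> alone; quotient and remainder modulo 2 then
      reassemble \<open>y j\<close>.\<close>
    then have "(j + 2) div 6 \<notin> J" using assms(2) by force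
    then have "(j + 2) div 6 \<in> snd (release_marks k (J, y)) \<longleftrightarrow> odd (y j)"
      using i by (simp add: release_marks_def)
    then show ?thesis using True by (simp add: release_marks_def absorb_marks_def)
  next
    case False
    then show ?thesis using assms(1)
      by (auto simp: release_marks_def absorb_marks_def extensional_def)
  qed
  ultimately show ?thesis by (simp add: prod_eq_iff fun_eq_iff)
qed

text \<open>Stating the fibre condition over the integers makes each fibre literally the set counted
  by \<open>restricted_partitions\<close>, empty when the marks in J outweigh
  \<open>n\<close>.\<close>

lemma bij_betw_absorb_marks:
  "bij_betw (absorb_marks k) (marked_partitions k n)
     (SIGMA J:Pow {(k + 1) div 2 + 1..k}. {y \<in> {1..3 * k + 1} \<rightarrow>\<^sub>E UNIV.
        int (\<Sum>j = 1..3 * k + 1. diamond_part j * y j) = int n - int (\<Sum>i\<in>J. 3 * i - 1)})"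
  (is "bij_betw _ _ ?S")
proof (rule bij_betw_byWitness[where f' = "release_marks k"])
  show "\<forall>p\<in>marked_partitions k n. release_marks k (absorb_marks k p) = p"
    by (clarsimp simp: marked_partitions_def PiE_def release_absorb)
  show "\<forall>p\<in>?S. absorb_marks k (release_marks k p) = p"
  proof
    fix p assume "p \<in> ?S"
    then obtain J y where "p = (J, y)" "J \<subseteq> {(k + 1) div 2 + 1..k}" "y \<in> extensional {1..3 * k + 1}"
      unfolding PiE_def by blast
    then show "absorb_marks k (release_marks k p) = p" using absorb_release by simp
  qed
  show "absorb_marks k ` marked_partitions k n \<subseteq> ?S"
  proof
    fix p assume "p \<in> absorb_marks k ` marked_partitions k n"
    then obtain x E where p: "p = absorb_marks k (x, E)" and xE: "(x, E) \<in> marked_partitions k n"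
      by auto
    obtain J y where Jy: "p = (J, y)" by fastforce
    have "J = fst (absorb_marks k (x, E))" "y = snd (absorb_marks k (x, E))"
      by (simp_all flip: p add: Jy)
    then have J: "J \<subseteq> {(k + 1) div 2 + 1..k}" and y: "y \<in> {1..3 * k + 1} \<rightarrow>\<^sub>E UNIV"
      by (simp_all add: absorb_marks_def)
    have "E \<subseteq> {1..k}" and n: "(\<Sum>j = 1..3 * k + 1. j * x j) + (\<Sum>i\<in>E. 3 * i - 1) = n"
      using xE by (simp_all add: marked_partitions_def)
    then have "(\<Sum>j = 1..3 * k + 1. diamond_part j * y j) + (\<Sum>i\<in>J. 3 * i - 1) = n"
      using absorb_marks_weight[of E k x] unfolding n p[symmetric] Jy fst_conv snd_conv by blast
    then have "int (\<Sum>j = 1..3 * k + 1. diamond_part j * y j) = int n - int (\<Sum>i\<in>J. 3 * i - 1)"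
      by linarith
    then show "p \<in> ?S" unfolding Jy using J y by blast
  qed
  show "release_marks k ` ?S \<subseteq> marked_partitions k n"
  proof
    fix p assume "p \<in> release_marks k ` ?S"
    then obtain J y where p: "p = release_marks k (J, y)" and Jy: "(J, y) \<in> ?S" by blast
    obtain x E where xE: "p = (x, E)" by fastforce
    have J: "J \<subseteq> {(k + 1) div 2 + 1..k}" and y: "y \<in> extensional {1..3 * k + 1}"
      using Jy by (simp_all add: PiE_def)
    have E: "E \<subseteq> {1..k}" and x: "x \<in> {1..3 * k + 1} \<rightarrow>\<^sub>E UNIV"
      using p xE J by (fastforce simp: release_marks_def)+
    \<comment> \<open>Since absorbing undoes releasing, the weight identity for
      \<open>absorb_marks\<close> also gives the weight after releasing.\<close>
    have "absorb_marks k (x, E) = (J, y)"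
      using absorb_release[OF y J] p xE by simp
    then have "(\<Sum>j = 1..3 * k + 1. j * x j) + (\<Sum>i\<in>E. 3 * i - 1)
      = (\<Sum>j = 1..3 * k + 1. diamond_part j * y j) + (\<Sum>i\<in>J. 3 * i - 1)"
      using absorb_marks_weight[OF E, of x] by simp
    also have "\<dots> = n"
    proof -
      have "int (\<Sum>j = 1..3 * k + 1. diamond_part j * y j) = int n - int (\<Sum>i\<in>J. 3 * i - 1)"
        using Jy by blast
      then show ?thesis by linarith
    qed
    finally show "p \<in> marked_partitions k n"
      using E x by (simp add: xE marked_partitions_def)
  qed
qed

section \<open>Counting through the two bijections\<close>

theorem proposition3p1:
  fixes k n :: nat
  assumes "k \<ge> 1"
  defines "\<alpha> \<equiv> (k + 1) div 2"
  shows "num_diamonds k n =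
    (\<Sum>J \<in> Pow {\<alpha> + 1..k}.
       restricted_partitions (3 * k + 1) diamond_part (int n - int (\<Sum>i\<in>J. (3 * i - 1))))"
proof -
  have "num_diamonds k n = card (marked_partitions k n)"
    unfolding num_diamonds_def by (rule bij_betw_same_card[OF bij_betw_diamond_encode])
  also have "\<dots> = card (SIGMA J:Pow {\<alpha> + 1..k}. {y \<in> {1..3 * k + 1} \<rightarrow>\<^sub>E UNIV.
      int (\<Sum>j = 1..3 * k + 1. diamond_part j * y j) = int n - int (\<Sum>i\<in>J. 3 * i - 1)})"
    unfolding \<alpha>_def by (rule bij_betw_same_card[OF bij_betw_absorb_marks])
  \<comment> \<open>The dependent sum is counted fibre by fibre. Its fibres are finite because all
    parts are positive: a halved part comes from some \<open>j \<ge> 4\<close>.\<close>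
  also have "\<dots> = (\<Sum>J \<in> Pow {\<alpha> + 1..k}.
      restricted_partitions (3 * k + 1) diamond_part (int n - int (\<Sum>i\<in>J. 3 * i - 1)))"
    unfolding restricted_partitions_def
    by (intro card_SigmaI ballI finite_restricted_partitions) (auto simp: diamond_part_def)
  finally show ?thesis .
qed

end
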